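(* Let $\beta\in c_{\rm inc}$ with $\beta(-1)=0$, let $w(k)>0$ for all $k\in\mathbb{N}$ with $\sum_kw(k)=1$, and let $\alpha:\mathbb{N}\to\mathbb{C}$ satisfy $\sum_{k\ge0}|\beta(k-1)-\alpha(k)|^2w(k)<\infty$. Let $D_{\beta,\tau_w}$ be the closure in $H_{\tau_w}$ of the operator defined on $\mathcal{A}$ by $D_{\beta,\tau_w}a=\beta(\mathbb{K}-1)a-a\,\alpha(\mathbb{K})$. Then $D_{\beta,\tau_w}$ has compact parametrices if and only if $$\beta(k+n-1)-\alpha(k)\to\infty\quad\text{and}\quad\beta(k-1)-\alpha(k+n)\to\infty$$ as $n,k\to\infty$, in the sense that for every $R>0$ there are only finitely many pairs $(k,n)$ with $k\ge0,\ n\ge0$ and $|\beta(k+n-1)-\alpha(k)|\le R$, and only finitely many pairs $(k,n)$ with $k\ge0,\ n\ge1$ and $|\beta(k-1)-\alpha(k+n)|\le R$.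
   Context: $\mathbb{N}$ is the set of nonnegative integers, $\{E_k\}$ the canonical basis of $\ell^2(\mathbb{N})$, $U$ the unilateral shift $UE_k=E_{k+1}$; for a function $b$ on $\mathbb{N}$, $b(\mathbb{K})E_k=b(k)E_k$, and $\beta(\mathbb{K}-1)E_k=\beta(k-1)E_k$ with $\beta(-1):=0$. $c_{\rm inc}$ is the set of $\beta:\mathbb{N}\to\mathbb{C}$ such that $\{\beta(k)-\beta(k-1)\}_{k\ge0}$ converges. $\mathcal{A}=\operatorname{Pol}(U,U^* )$, which consists of the finite sums $a=\sum_{n\ge0}U^na_n^+(\mathbb{K})+\sum_{n\ge1}a_n^-(\mathbb{K})(U^* )^n$ with $a_n^\pm$ eventually constant. $H_{\tau_w}$ is the GNS Hilbert space of the state $\tau_w(a)=\operatorname{tr}(w(\mathbb{K})a)$ on the Toeplitz algebra, identified with the space of formal series $f=\sum_{n\ge0}U^nf_n^+(\mathbb{K})+\sum_{n\ge1}f_n^-(\mathbb{K})(U^* )^n$, $f_n^\pm:\mathbb{N}\to\mathbb{C}$, with finite norm $$\|f\|^2=\sum_{n\ge0}\sum_{k\ge0}w(k)|f_n^+(k)|^2+\sum_{n\ge1}\sum_{k\ge0}w(k+n)|f_n^-(k)|^2,$$ so that $\mathcal{A}\subset H_{\tau_w}$ is dense. Products with diagonal operators are computed using $b(\mathbb{K})U=Ub(\mathbb{K}+1)$, so that $\beta(\mathbb{K}-1)a-a\alpha(\mathbb{K})=\sum_{n\ge0}U^n(\beta(\mathbb{K}+n-1)-\alpha(\mathbb{K}))a_n^+(\mathbb{K})+\sum_{n\ge1}(\beta(\mathbb{K}-1)-\alpha(\mathbb{K}+n))a_n^-(\mathbb{K})(U^*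 )^n$. A closed densely defined operator $D$ has compact parametrices if $(I+D^*D)^{-1/2}$ and $(I+DD^* )^{-1/2}$ are compact. *)

theory Defs
  imports "HOL-Analysis.Analysis" "HOL-Library.Function_Algebras"
begin

section \<open>Unbounded operators on a complex Hilbert space given by a carrier set\<close>

text \<open>
  The Hilbert space depends on the weight, so it is a carrier set \<open>H\<close> inside an ambient group,
  with scalar multiplication \<open>smult\<close> and inner product \<open>ip\<close> (linear in the first argument).
  The locale carries no axioms: it only collects notions that are meant to be used when
  \<open>(H, smult, ip)\<close> is a complex Hilbert space.
  Operators are identified with their graphs, so that \<open>S O T\<close> is ``first \<open>S\<close>, then \<open>T\<close>''
  on its maximal domain and \<open>T\<inverse>\<close> is the inverse.
\<close>

locale hilbert_operators =
  fixes H :: "'v::ab_group_add set"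
    and smult :: "complex \<Rightarrow> 'v \<Rightarrow> 'v"
    and ip :: "'v \<Rightarrow> 'v \<Rightarrow> complex"
begin

definition hnorm :: "'v \<Rightarrow> real" where
  "hnorm x = sqrt (Re (ip x x))"

definition htop :: "'v topology" where
  "htop = Metric_space.mtopology H (\<lambda>x y. hnorm (x - y))"

definition linear_operator :: "('v \<times> 'v) set \<Rightarrow> bool" where
  "linear_operator T \<longleftrightarrow>
     T \<subseteq> H \<times> H \<and> single_valued T \<and> (0, 0) \<in> T \<and>
     (\<forall>x y x' y'. (x, y) \<in> T \<longrightarrow> (x', y') \<in> T \<longrightarrow> (x + x', y + y') \<in> T) \<and>
     (\<forall>c x y. (x, y) \<in> T \<longrightarrow> (smult c x, smult c y) \<in> T)"

definition op_closure :: "('v \<times> 'v) set \<Rightarrow> ('v \<times> 'v) set" where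
  "op_closure T = prod_topology htop htop closure_of T"

definition closed_densely_defined :: "('v \<times> 'v) set \<Rightarrow> bool" where
  "closed_densely_defined T \<longleftrightarrow>
     linear_operator T \<and> closedin (prod_topology htop htop) T \<and> htop closure_of (Domain T) = H"

definition adjoint_op :: "('v \<times> 'v) set \<Rightarrow> ('v \<times> 'v) set" where
  "adjoint_op T = {(y, z) \<in> H \<times> H. \<forall>(x, u) \<in> T. ip u y = ip x z}"

definition id_plus :: "('v \<times> 'v) set \<Rightarrow> ('v \<times> 'v) set" where
  "id_plus T = {(x, x + y) | x y. (x, y) \<in> T}"

definition bounded_operator :: "('v \<times> 'v) set \<Rightarrow> bool" where
  "bounded_operator S \<longleftrightarrow>
     linear_operator S \<and> Domain S = H \<and> (\<exists>C. \<forall>(x, y) \<in> S. hnorm y \<le> C * hnorm x)"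

definition positive_operator :: "('v \<times> 'v) set \<Rightarrow> bool" where
  "positive_operator S \<longleftrightarrow> bounded_operator S \<and> (\<forall>(x, y) \<in> S. ip y x \<in> \<real>\<^sub>\<ge>\<^sub>0)"

text \<open>
  The positive square root is unique whenever \<open>T\<close> is a bounded positive operator; it is only
  applied to \<open>(I + D\<^sup>*D)\<inverse>\<close> and \<open>(I + DD\<^sup>*)\<inverse>\<close> for \<open>D\<close> closed and densely defined.
\<close>

definition pos_sqrt :: "('v \<times> 'v) set \<Rightarrow> ('v \<times> 'v) set" where
  "pos_sqrt T = (THE S. positive_operator S \<and> S O S = T)"

definition compact_operator :: "('v \<times> 'v) set \<Rightarrow> bool" where
  "compact_operator S \<longleftrightarrow>
     linear_operator S \<and> Domain S = H \<and>
     compactin htop (htop closure_of (S `` {x \<in> H. hnorm x \<le> 1}))"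

text \<open>Note that \<open>D\<^sup>*D\<close> is \<open>D O adjoint_op D\<close> and \<open>DD\<^sup>*\<close> is \<open>adjoint_op D O D\<close>.\<close>

definition compact_parametrices :: "('v \<times> 'v) set \<Rightarrow> bool" where
  "compact_parametrices D \<longleftrightarrow>
     closed_densely_defined D \<and>
     compact_operator (pos_sqrt ((id_plus (D O adjoint_op D))\<inverse>)) \<and>
     compact_operator (pos_sqrt ((id_plus (adjoint_op D O D))\<inverse>))"

end


section \<open>The GNS space of \<open>\<tau>\<^sub>w\<close> as a space of formal series\<close>

text \<open>
  The series \<open>\<Sum>\<^sub>n\<^sub>\<ge>\<^sub>0 U\<^sup>n f\<^sub>n\<^sup>+(K) + \<Sum>\<^sub>n\<^sub>\<ge>\<^sub>1 f\<^sub>n\<^sup>-(K) (U\<^sup>*)\<^sup>n\<close> is encoded by a single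
  family indexed by integers: \<open>f m = f\<^sub>m\<^sup>+\<close> for \<open>m \<ge> 0\<close> and \<open>f (- n) = f\<^sub>n\<^sup>-\<close> for \<open>n \<ge> 1\<close>.
  Thus \<open>nat m\<close> is \<open>n\<close> on the plus part and \<open>0\<close> on the minus part, and \<open>nat (- m)\<close> is \<open>0\<close>
  on the plus part and \<open>n\<close> on the minus part.
\<close>

type_synonym series = "int \<Rightarrow> nat \<Rightarrow> complex"

definition series_smult :: "complex \<Rightarrow> series \<Rightarrow> series" where
  "series_smult c f = (\<lambda>m k. c * f m k)"

definition gns_weight :: "(nat \<Rightarrow> real) \<Rightarrow> int \<Rightarrow> nat \<Rightarrow> real" where
  "gns_weight w m k = w (k + nat (- m))"

definition gns_space :: "(nat \<Rightarrow> real) \<Rightarrow> series set" where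
  "gns_space w = {f. (\<lambda>(m, k). gns_weight w m k * (cmod (f m k))\<^sup>2) summable_on UNIV}"

definition gns_ip :: "(nat \<Rightarrow> real) \<Rightarrow> series \<Rightarrow> series \<Rightarrow> complex" where
  "gns_ip w f g =
     (\<Sum>\<^sub>\<infinity>(m, k) \<in> UNIV. complex_of_real (gns_weight w m k) * f m k * cnj (g m k))"

text \<open>The polynomial algebra \<open>Pol(U, U\<^sup>*)\<close>.\<close>

definition pol_algebra :: "series set" where
  "pol_algebra =
     {a. finite {m. \<exists>k. a m k \<noteq> 0} \<and> (\<forall>m. \<exists>c. eventually (\<lambda>k. a m k = c) sequentially)}"

text \<open>
  Left and right multiplication of a series by a diagonal operator \<open>b(K)\<close>, rewritten in normal
  form: \<open>b(K) U\<^sup>n = U\<^sup>n b(K + n)\<close> and \<open>(U\<^sup>*)\<^sup>n b(K) = b(K + n) (U\<^sup>*)\<^sup>n\<close>.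
\<close>

definition diag_left :: "(nat \<Rightarrow> complex) \<Rightarrow> series \<Rightarrow> series" where
  "diag_left b f = (\<lambda>m k. b (k + nat m) * f m k)"

definition diag_right :: "series \<Rightarrow> (nat \<Rightarrow> complex) \<Rightarrow> series" where
  "diag_right f b = (\<lambda>m k. f m k * b (k + nat (- m)))"

text \<open>\<open>shift_down \<beta> k\<close> is \<open>\<beta>(k - 1)\<close> with the convention \<open>\<beta>(-1) = 0\<close>.\<close>

definition shift_down :: "(nat \<Rightarrow> complex) \<Rightarrow> nat \<Rightarrow> complex" where
  "shift_down \<beta> k = (case k of 0 \<Rightarrow> 0 | Suc j \<Rightarrow> \<beta> j)"

definition c_inc :: "(nat \<Rightarrow> complex) set" where
  "c_inc = {\<beta>. convergent (\<lambda>k. \<beta> k - shift_down \<beta> k)}"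

definition D_pol :: "(nat \<Rightarrow> complex) \<Rightarrow> (nat \<Rightarrow> complex) \<Rightarrow> (series \<times> series) set" where
  "D_pol \<beta> \<alpha> =
     {(a, diag_left (shift_down \<beta>) a - diag_right a \<alpha>) | a. a \<in> pol_algebra}"

definition D_gns :: "(nat \<Rightarrow> real) \<Rightarrow> (nat \<Rightarrow> complex) \<Rightarrow> (nat \<Rightarrow> complex) \<Rightarrow> (series \<times> series) set" where
  "D_gns w \<beta> \<alpha> = hilbert_operators.op_closure (gns_space w) (gns_ip w) (D_pol \<beta> \<alpha>)"

definition gns_compact_parametrices :: "(nat \<Rightarrow> real) \<Rightarrow> (series \<times> series) set \<Rightarrow> bool" where
  "gns_compact_parametrices w =
     hilbert_operators.compact_parametrices (gns_space w) series_smult (gns_ip w)"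

end

theory Submission
  imports Defs "HOL-Complex_Analysis.Great_Picard"
begin

text \<open>
  In the coordinates \<open>f m k\<close> of a series, left and right multiplication by diagonal operators
  do not mix coordinates. The GNS space is a weighted \<open>\<ell>\<^sup>2\<close> space over \<open>\<int> \<times> \<nat>\<close>, and
  \<open>a \<mapsto> \<beta>(K - 1) a - a \<alpha>(K)\<close> is multiplication by the scalar family
  \<open>\<mu> m k = \<beta>(k + n - 1) - \<alpha>(k)\<close> for \<open>m = n \<ge> 0\<close> and
  \<open>\<mu> m k = \<beta>(k - 1) - \<alpha>(k + n)\<close> for \<open>m = - n < 0\<close>.

  The polynomial algebra contains all finitely supported series, and these form a core of the
  multiplication operator on its maximal domain; hence the closure \<open>D\<close> is multiplication by
  \<open>\<mu>\<close> on that domain (\<open>mult_op_closure\<close>). Its adjoint is multiplication by the conjugate of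
  \<open>\<mu>\<close> (\<open>adjoint_mult_op\<close>), so \<open>(I + D\<^sup>*D)\<inverse>\<close> and \<open>(I + DD\<^sup>*)\<inverse>\<close> are both multiplication by
  \<open>1 / (1 + |\<mu>|\<^sup>2)\<close> (\<open>resolvent_mult_op\<close>). The only positive square root of this operator is
  multiplication by \<open>r = 1 / sqrt (1 + |\<mu>|\<^sup>2)\<close> (\<open>pos_sqrt_mult_op\<close>).

  A bounded multiplication operator is compact exactly when its symbol tends to zero, in the
  sense that each set \<open>{|r| \<ge> \<epsilon>}\<close> is finite (\<open>compact_mult_opI\<close>, \<open>compact_mult_opD\<close>). For
  this \<open>r\<close> the condition says that each set \<open>{|\<mu>| \<le> R}\<close> is finite, and splitting the latter
  by the sign of \<open>m\<close> gives the two families of pairs in the statement.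
\<close>

section \<open>Weighted square-summable families\<close>

lemma infsum_complex_of_real:
  "(\<Sum>\<^sub>\<infinity>x\<in>A. complex_of_real (f x)) = complex_of_real (infsum f A)"
proof (cases "f summable_on A")
  case True
  then show ?thesis
    by (intro infsumI) (simp add: has_sum_of_real_iff has_sum_infsum)
next
  case False
  then have "\<not> (\<lambda>x. complex_of_real (f x)) summable_on A"
    using summable_on_Re by fastforce
  then show ?thesis using False by (simp add: infsum_not_exists)
qed

text \<open>Families have two arguments rather than one argument in a product type, so that series
  are literally elements of the space.\<close>

locale weighted_l2 =
  fixes W :: "'a::countable \<Rightarrow> 'b::countable \<Rightarrow> real"
  assumes W_pos: "W a b > 0"
begin

definition L2 :: "('a \<Rightarrow> 'b \<Rightarrow> complex) set" where
  "L2 = {f. (\<lambda>(a, b). W a b * (cmod (f a b))\<^sup>2) summable_on UNIV}"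

definition ip :: "('a \<Rightarrow> 'b \<Rightarrow> complex) \<Rightarrow> ('a \<Rightarrow> 'b \<Rightarrow> complex) \<Rightarrow> complex" where
  "ip f g = (\<Sum>\<^sub>\<infinity>(a, b) \<in> UNIV. complex_of_real (W a b) * f a b * cnj (g a b))"

definition scale :: "complex \<Rightarrow> ('a \<Rightarrow> 'b \<Rightarrow> complex) \<Rightarrow> ('a \<Rightarrow> 'b \<Rightarrow> complex)" where
  "scale c f = (\<lambda>a b. c * f a b)"

definition energy :: "('a \<Rightarrow> 'b \<Rightarrow> complex) \<Rightarrow> 'a \<times> 'b \<Rightarrow> real" where
  "energy f p = W (fst p) (snd p) * (cmod (f (fst p) (snd p)))\<^sup>2"

sublocale hilbert_operators L2 scale ip .

lemma scale_apply [simp]: "scale c f a b = c * f a b"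
  by (simp add: scale_def)

lemma energy_nonneg [simp]: "energy f p \<ge> 0"
  using W_pos[of "fst p" "snd p"] by (simp add: energy_def)

lemma mem_L2: "f \<in> L2 \<longleftrightarrow> energy f summable_on UNIV"
proof -
  have "(\<lambda>(a, b). W a b * (cmod (f a b))\<^sup>2) = energy f"
    by (auto simp: energy_def)
  then show ?thesis by (simp add: L2_def)
qed

lemma ip_self: "ip f f = of_real (infsum (energy f) UNIV)"
proof -
  have "(\<lambda>(a, b). complex_of_real (W a b) * f a b * cnj (f a b)) = (\<lambda>p. of_real (energy f p))"
    by (auto simp: energy_def mult.assoc simp flip: complex_norm_square)
  then show ?thesis
    by (simp add: ip_def infsum_complex_of_real)
qed

lemma hnorm_eq: "hnorm f = sqrt (infsum (energy f) UNIV)"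
  by (simp add: hnorm_def ip_self)

lemma hnorm_nonneg [simp]: "hnorm f \<ge> 0"
  by (simp add: hnorm_eq infsum_nonneg)

lemma hnorm_sq: "(hnorm f)\<^sup>2 = infsum (energy f) UNIV"
  by (simp add: hnorm_eq infsum_nonneg)

lemma sum_energy_le:
  assumes "f \<in> L2" "finite F"
  shows "sum (energy f) F \<le> (hnorm f)\<^sup>2"
  unfolding hnorm_sq using assms by (intro finite_sum_le_infsum) (auto simp: mem_L2)

text \<open>Bounds on finite partial sums suffice, so that estimates on \<^term>\<open>L2\<close> reduce to
  finite sums.\<close>

lemma L2_bounded:
  assumes "B \<ge> 0" "\<And>F. finite F \<Longrightarrow> sum (energy f) F \<le> B\<^sup>2"
  shows "f \<in> L2" "hnorm f \<le> B"
proof -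
  show *: "f \<in> L2"
    unfolding mem_L2
    by (rule nonneg_bounded_partial_sums_imp_summable_on[where C = "B\<^sup>2"])
       (auto intro!: eventually_finite_subsets_at_top_weakI assms)
  have "(hnorm f)\<^sup>2 \<le> B\<^sup>2"
    unfolding hnorm_sq using * assms(2) by (intro infsum_le_finite_sums) (auto simp: mem_L2)
  then show "hnorm f \<le> B"
    using assms(1) by (rule power2_le_imp_le)
qed

lemma coordinate_le:
  assumes "f \<in> L2"
  shows "sqrt (W a b) * cmod (f a b) \<le> hnorm f"
proof (rule power2_le_imp_le)
  show "(sqrt (W a b) * cmod (f a b))\<^sup>2 \<le> (hnorm f)\<^sup>2"
    using sum_energy_le[OF assms, of "{(a, b)}"] W_pos[of a b]
    by (simp add: energy_def power_mult_distrib)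
qed simp

lemma hnorm_eq_0D:
  assumes "f \<in> L2" "hnorm f = 0"
  shows "f = 0"
proof (intro ext)
  fix a b
  have "sqrt (W a b) * cmod (f a b) \<le> 0"
    using coordinate_le[OF assms(1), of a b] assms(2) by simp
  moreover have "sqrt (W a b) > 0" using W_pos by simp
  ultimately show "f a b = 0 a b"
    by (auto simp: mult_le_0_iff)
qed

lemma zero_in_L2 [simp]: "0 \<in> L2" and hnorm_0 [simp]: "hnorm 0 = 0"
  using L2_bounded[of 0 0] by (auto simp: energy_def hnorm_nonneg order_antisym)

text \<open>This is the source of membership in \<^term>\<open>L2\<close> and of all operator norm bounds for
  multiplications.\<close>

lemma dominated:
  assumes "f \<in> L2" "C \<ge> 0" "\<And>a b. cmod (g a b) \<le> C * cmod (f a b)"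
  shows "g \<in> L2" "hnorm g \<le> C * hnorm f"
proof -
  have "sum (energy g) F \<le> (C * hnorm f)\<^sup>2" if "finite F" for F
  proof -
    have "energy g p \<le> C\<^sup>2 * energy f p" for p
    proof -
      have "(cmod (g (fst p) (snd p)))\<^sup>2 \<le> (C * cmod (f (fst p) (snd p)))\<^sup>2"
        using assms(3) by (intro power_mono) auto
      then have "W (fst p) (snd p) * (cmod (g (fst p) (snd p)))\<^sup>2
          \<le> W (fst p) (snd p) * (C * cmod (f (fst p) (snd p)))\<^sup>2"
        using W_pos[of "fst p" "snd p"] by (intro mult_left_mono) auto
      then show ?thesis
        by (simp add: energy_def power_mult_distrib mult_ac)
    qed
    then have "sum (energy g) F \<le> C\<^sup>2 * sum (energy f) F"
      by (simp add: sum_distrib_left sum_mono)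
    also have "\<dots> \<le> C\<^sup>2 * (hnorm f)\<^sup>2"
      using sum_energy_le[OF assms(1) that] by (intro mult_left_mono) auto
    finally show ?thesis by (simp add: power_mult_distrib)
  qed
  then show "g \<in> L2" "hnorm g \<le> C * hnorm f"
    using L2_bounded[of "C * hnorm f" g] assms(2) by auto
qed

lemma hnorm_add:
  assumes "f \<in> L2" "g \<in> L2"
  shows "f + g \<in> L2" "hnorm (f + g) \<le> hnorm f + hnorm g"
proof -
  \<comment> \<open>With this rescaling the triangle inequality is that of the unweighted finite \<open>\<ell>\<^sup>2\<close> norm.\<close>
  define v where "v h p = sqrt (W (fst p) (snd p)) * cmod (h (fst p) (snd p))" for h p
  have v: "L2_set (v h) F = sqrt (sum (energy h) F)" for h F
    unfolding L2_set_def v_def energy_def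
    using W_pos by (simp add: power_mult_distrib less_imp_le)
  have "sum (energy (f + g)) F \<le> (hnorm f + hnorm g)\<^sup>2" if "finite F" for F
  proof -
    have "L2_set (v (f + g)) F \<le> L2_set (\<lambda>p. v f p + v g p) F"
      unfolding v_def using W_pos
      by (intro L2_set_mono)
         (auto simp: less_imp_le norm_triangle_ineq simp flip: distrib_left)
    also have "\<dots> \<le> L2_set (v f) F + L2_set (v g) F"
      by (rule L2_set_triangle_ineq)
    also have "\<dots> \<le> hnorm f + hnorm g"
      unfolding v using sum_energy_le[OF _ that] assms
      by (intro add_mono) (auto intro!: real_le_lsqrt sum_nonneg)
    finally show ?thesis unfolding v
      by (rule sqrt_le_D)
  qed
  then show "f + g \<in> L2" "hnorm (f + g) \<le> hnorm f + hnorm g"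
    using L2_bounded[of "hnorm f + hnorm g" "f + g"] by auto
qed

lemma scale_in_L2: "f \<in> L2 \<Longrightarrow> scale c f \<in> L2"
  by (rule dominated(1)[where C = "cmod c"]) (auto simp: norm_mult)

lemma hnorm_diff_commute: "hnorm (f - g) = hnorm (g - f)"
proof -
  have "energy (f - g) = energy (g - f)"
    by (auto simp: energy_def norm_minus_commute)
  then show ?thesis by (simp add: hnorm_eq)
qed

lemma diff_in_L2: "f \<in> L2 \<Longrightarrow> g \<in> L2 \<Longrightarrow> f - g \<in> L2"
  using hnorm_add(1)[of f "scale (-1) g"] scale_in_L2[of g "-1"]
  by (simp add: scale_def plus_fun_def fun_diff_def)

sublocale Metric_space L2 "\<lambda>f g. hnorm (f - g)"
proof
  fix f g h assume L2: "f \<in> L2" "g \<in> L2" "h \<in> L2"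
  show "hnorm (f - g) = 0 \<longleftrightarrow> f = g"
    using hnorm_eq_0D[OF diff_in_L2[OF L2(1,2)]] by auto
  show "hnorm (f - h) \<le> hnorm (f - g) + hnorm (g - h)"
    using hnorm_add(2)[OF diff_in_L2[OF L2(1,2)] diff_in_L2[OF L2(2,3)]] by simp
qed (auto simp: hnorm_diff_commute)

lemma htop_eq: "htop = mtopology"
  by (simp add: htop_def)

lemma topspace_htop [simp]: "topspace htop = L2"
  by (simp add: htop_eq)

lemma continuous_map_coordinate: "continuous_map htop euclidean (\<lambda>f. f a b)"
proof -
  have "openin mtopology {f \<in> L2. f a b \<in> U}" if "open U" for U
    unfolding openin_mtopology
  proof (intro conjI allI impI)
    fix f assume f: "f \<in> {f \<in> L2. f a b \<in> U}"
    then obtain e where e: "e > 0" "ball (f a b) e \<subseteq> U"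
      using \<open>open U\<close> open_contains_ball[of U] by blast
    have "g \<in> {f \<in> L2. f a b \<in> U}" if "g \<in> mball f (e * sqrt (W a b))" for g
    proof -
      have g: "g \<in> L2" "hnorm (f - g) < e * sqrt (W a b)" using that by auto
      then have "sqrt (W a b) * cmod (f a b - g a b) < sqrt (W a b) * e"
        using coordinate_le[of "f - g" a b] diff_in_L2[of f g] f by (simp add: mult.commute)
      then have "dist (f a b) (g a b) < e"
        using W_pos[of a b] by (simp add: dist_norm)
      then show ?thesis using e g by auto
    qed
    then show "\<exists>r>0. mball f r \<subseteq> {f \<in> L2. f a b \<in> U}"
      using e(1) W_pos[of a b] by (intro exI[of _ "e * sqrt (W a b)"]) auto
  qed auto
  then show ?thesis by (simp add: continuous_map_def htop_eq)
qed

subsection \<open>Truncations\<close>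

definition trunc :: "('a \<times> 'b) set \<Rightarrow> ('a \<Rightarrow> 'b \<Rightarrow> complex) \<Rightarrow> ('a \<Rightarrow> 'b \<Rightarrow> complex)" where
  "trunc F f = (\<lambda>a b. if (a, b) \<in> F then f a b else 0)"

lemma trunc_in_L2: "f \<in> L2 \<Longrightarrow> trunc F f \<in> L2"
  by (rule dominated(1)[where C = 1]) (auto simp: trunc_def)

text \<open>The estimate holds for all larger sets, so that approximations of several families can
  share one set.\<close>

lemma trunc_approx:
  assumes "f \<in> L2" "\<epsilon> > 0"
  shows "\<exists>F. finite F \<and> (\<forall>G. finite G \<longrightarrow> F \<subseteq> G \<longrightarrow> hnorm (f - trunc G f) < \<epsilon>)"
proof -
  have "(sum (energy f) \<longlongrightarrow> (hnorm f)\<^sup>2) (finite_subsets_at_top UNIV)"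
    using assms(1) has_sum_infsum by (simp add: mem_L2 hnorm_sq has_sum_def[symmetric])
  then have "\<forall>\<^sub>F F in finite_subsets_at_top UNIV. sum (energy f) F > (hnorm f)\<^sup>2 - (\<epsilon> / 2)\<^sup>2"
    using assms(2) by (intro order_tendstoD) auto
  then obtain F where F: "finite F"
      "\<And>G. finite G \<Longrightarrow> F \<subseteq> G \<Longrightarrow> sum (energy f) G > (hnorm f)\<^sup>2 - (\<epsilon> / 2)\<^sup>2"
    by (auto simp: eventually_finite_subsets_at_top)
  show ?thesis
  proof (intro exI[of _ F] conjI allI impI F(1))
    fix G assume G: "finite G" "F \<subseteq> G"
    have "sum (energy (f - trunc G f)) E \<le> (\<epsilon> / 2)\<^sup>2" if "finite E" for E
    proof -
      have "sum (energy (f - trunc G f)) E = sum (energy f) (E - G)"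
        using that by (intro sum.mono_neutral_cong_right) (auto simp: energy_def trunc_def)
      also have "\<dots> = sum (energy f) (E \<union> G) - sum (energy f) G"
        using that G by (subst sum_diff[symmetric]) (auto intro!: sum.cong)
      also have "\<dots> \<le> (\<epsilon> / 2)\<^sup>2"
        using F(2)[OF G] sum_energy_le[OF assms(1), of "E \<union> G"] that G by simp
      finally show ?thesis .
    qed
    then have "hnorm (f - trunc G f) \<le> \<epsilon> / 2"
      using assms(2) by (intro L2_bounded(2)) auto
    then show "hnorm (f - trunc G f) < \<epsilon>" using assms(2) by simp
  qed
qed

section \<open>Multiplication operators\<close>

definition mult_op :: "('a \<Rightarrow> 'b \<Rightarrow> complex) \<Rightarrow> (('a \<Rightarrow> 'b \<Rightarrow> complex) \<times> ('a \<Rightarrow> 'b \<Rightarrow> complex)) set" where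
  "mult_op \<mu> = {(f, \<mu> * f) | f. f \<in> L2 \<and> \<mu> * f \<in> L2}"

lemma mem_mult_op: "(f, g) \<in> mult_op \<mu> \<longleftrightarrow> f \<in> L2 \<and> g \<in> L2 \<and> g = \<mu> * f"
  by (auto simp: mult_op_def)

lemma linear_mult_op: "linear_operator (mult_op \<mu>)"
proof -
  have scale: "\<mu> * scale c f = scale c (\<mu> * f)" for c f by (intro ext) simp
  show ?thesis
    unfolding linear_operator_def
    by (auto simp: mem_mult_op single_valued_def hnorm_add scale scale_in_L2 distrib_left)
qed

text \<open>Norm convergence implies convergence of every coordinate, and the graph is cut out by one
  equation per coordinate.\<close>

lemma closedin_mult_op: "closedin (prod_topology htop htop) (mult_op \<mu>)"
proof -
  let ?X = "prod_topology htop htop"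
  let ?C = "\<lambda>p. {q \<in> topspace ?X. snd q (fst p) (snd p) - \<mu> (fst p) (snd p) * fst q (fst p) (snd p) \<in> {0}}"
  have "closedin ?X (?C p)" for p
  proof (intro closedin_continuous_map_preimage[where Y = euclidean] continuous_map_diff)
    show "continuous_map ?X euclidean (\<lambda>q. snd q (fst p) (snd p))"
      using continuous_map_compose[OF continuous_map_snd continuous_map_coordinate]
      by (simp add: o_def)
    have *: "continuous_map ?X euclidean (\<lambda>q. fst q (fst p) (snd p))"
      using continuous_map_compose[OF continuous_map_fst continuous_map_coordinate]
      by (simp add: o_def)
    have "continuous_map euclidean euclidean ((*) (\<mu> (fst p) (snd p)))"
      by (auto intro!: continuous_intros)
    from continuous_map_compose[OF * this]
    show "continuous_map ?X euclidean (\<lambda>q. \<mu> (fst p) (snd p) * fst q (fst p) (snd p))"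
      by (simp add: o_def)
  qed auto
  then have "closedin ?X (\<Inter>p. ?C p)" by blast
  moreover have "(\<Inter>p. ?C p) = mult_op \<mu>"
  proof
    show "(\<Inter>p. ?C p) \<subseteq> mult_op \<mu>"
    proof
      fix q assume q: "q \<in> (\<Inter>p. ?C p)"
      then have "snd q a b = \<mu> a b * fst q a b" for a b
        using INT_D[OF q, of "(a, b)"] by simp
      then have "snd q = \<mu> * fst q" by (intro ext) simp
      then show "q \<in> mult_op \<mu>"
        using INT_D[OF q, of undefined] by (cases q) (simp add: mem_mult_op)
    qed
  qed (auto simp: mem_mult_op)
  ultimately show ?thesis by simp
qed

text \<open>The finitely supported families form a core of every multiplication operator: truncation
  commutes with multiplication, so truncating to one large finite set approximates \<open>f\<close> and
  \<open>\<mu> * f\<close> at the same time. In the other direction the graph of the maximal operator is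
  closed.\<close>

lemma mult_op_closure:
  assumes core: "\<And>f F. finite F \<Longrightarrow> (trunc F f, \<mu> * trunc F f) \<in> T"
    and graph: "\<And>f g. (f, g) \<in> T \<Longrightarrow> g = \<mu> * f"
  shows "op_closure T = mult_op \<mu>"
proof
  have sub: "topspace (prod_topology htop htop) \<inter> T \<subseteq> mult_op \<mu>"
  proof
    fix q assume "q \<in> topspace (prod_topology htop htop) \<inter> T"
    then show "q \<in> mult_op \<mu>"
      using graph[of "fst q" "snd q"] by (cases q) (simp add: mem_mult_op)
  qed
  have "op_closure T
      = prod_topology htop htop closure_of (topspace (prod_topology htop htop) \<inter> T)"
    unfolding op_closure_def by (rule closure_of_restrict)
  also have "\<dots> \<subseteq> mult_op \<mu>"
    by (rule closure_of_minimal[OF sub closedin_mult_op])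
  finally show "op_closure T \<subseteq> mult_op \<mu>" .
  show "mult_op \<mu> \<subseteq> op_closure T"
  proof
    fix q assume "q \<in> mult_op \<mu>"
    then obtain f where q: "q = (f, \<mu> * f)" and f: "f \<in> L2" "\<mu> * f \<in> L2"
      by (auto simp: mult_op_def)
    have "\<exists>y. y \<in> T \<and> y \<in> S"
      if S: "(f, \<mu> * f) \<in> S" and op: "openin (prod_topology htop htop) S" for S
    proof -
      obtain U V where UV: "openin htop U" "openin htop V" "f \<in> U" "\<mu> * f \<in> V"
          "U \<times> V \<subseteq> S"
        using op[unfolded openin_prod_topology_alt, rule_format, OF S] by blast
      obtain r where r: "r > 0" "mball f r \<subseteq> U"
        using UV(1,3) unfolding htop_eq openin_mtopology by blast
      obtain s where s: "s > 0" "mball (\<mu> * f) s \<subseteq> V"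
        using UV(2,4) unfolding htop_eq openin_mtopology by blast
      obtain F where F: "finite F" "\<forall>G. finite G \<longrightarrow> F \<subseteq> G \<longrightarrow> hnorm (f - trunc G f) < r"
        using trunc_approx[OF f(1) r(1)] by blast
      obtain F' where F': "finite F'"
          "\<forall>G. finite G \<longrightarrow> F' \<subseteq> G \<longrightarrow> hnorm (\<mu> * f - trunc G (\<mu> * f)) < s"
        using trunc_approx[OF f(2) s(1)] by blast
      define G where "G = F \<union> F'"
      have G: "finite G" "F \<subseteq> G" "F' \<subseteq> G"
        using F(1) F'(1) by (auto simp: G_def)
      have eq: "\<mu> * trunc G f = trunc G (\<mu> * f)" by (intro ext) (simp add: trunc_def)
      have "trunc G f \<in> mball f r" "trunc G (\<mu> * f) \<in> mball (\<mu> * f) s"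
        using F(2)[rule_format, OF G(1,2)] F'(2)[rule_format, OF G(1,3)] f by (auto simp: trunc_in_L2)
      then have "(trunc G f, \<mu> * trunc G f) \<in> U \<times> V"
        unfolding eq by (intro SigmaI subsetD[OF r(2)] subsetD[OF s(2)])
      then have "(trunc G f, \<mu> * trunc G f) \<in> S"
        by (rule subsetD[OF UV(5)])
      then show ?thesis
        using core[OF G(1), of f] by blast
    qed
    then show "q \<in> op_closure T"
      unfolding op_closure_def in_closure_of q using f by simp
  qed
qed

lemma finite_trunc_in_L2: "finite F \<Longrightarrow> trunc F f \<in> L2"
  unfolding mem_L2
  by (rule finite_nonzero_values_imp_summable_on, erule finite_subset[rotated])
     (auto simp: energy_def trunc_def)

lemma closed_densely_defined_mult_op: "closed_densely_defined (mult_op \<mu>)"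
proof -
  have "htop closure_of (Domain (mult_op \<mu>)) = L2"
  proof -
    have "\<exists>g\<in>Domain (mult_op \<mu>). g \<in> mball f r" if f: "f \<in> L2" and r: "r > 0" for f r
    proof -
      obtain F where F: "finite F" "hnorm (f - trunc F f) < r"
        using trunc_approx[OF f r] by blast
      have "\<mu> * trunc F f = trunc F (\<mu> * f)" by (intro ext) (simp add: trunc_def)
      then have "\<mu> * trunc F f \<in> L2"
        using finite_trunc_in_L2[OF F(1)] by simp
      then have "trunc F f \<in> Domain (mult_op \<mu>)"
        using f by (auto simp: mem_mult_op trunc_in_L2 Domain_iff)
      then show ?thesis using F f by (intro bexI[of _ "trunc F f"]) (auto simp: trunc_in_L2)
    qed
    then show ?thesis unfolding htop_eq metric_closure_of by blast
  qed
  then show ?thesis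
    by (simp add: closed_densely_defined_def linear_mult_op closedin_mult_op)
qed

section \<open>Adjoints and resolvents\<close>

lemma ip_summable:
  assumes "f \<in> L2" "g \<in> L2"
  shows "(\<lambda>(a, b). complex_of_real (W a b) * f a b * cnj (g a b)) summable_on UNIV"
proof (rule abs_summable_summable, rule Infinite_Sum.abs_summable_on_comparison_test')
  show "(\<lambda>p. energy f p + energy g p) summable_on UNIV"
    using assms by (intro summable_on_add) (auto simp: mem_L2)
  fix p :: "'a \<times> 'b"
  obtain a b where p: "p = (a, b)" by fastforce
  have "cmod (f a b) * cmod (g a b) \<le> (cmod (f a b))\<^sup>2 + (cmod (g a b))\<^sup>2"
    using sum_squares_bound[of "cmod (f a b)" "cmod (g a b)"]
      mult_nonneg_nonneg[OF norm_ge_zero norm_ge_zero, of "f a b" "g a b"] by linarith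
  then have "W a b * (cmod (f a b) * cmod (g a b))
      \<le> W a b * ((cmod (f a b))\<^sup>2 + (cmod (g a b))\<^sup>2)"
    using W_pos[of a b] by (intro mult_left_mono) auto
  then show "norm (case p of (a, b) \<Rightarrow> complex_of_real (W a b) * f a b * cnj (g a b))
      \<le> energy f p + energy g p"
    using W_pos[of a b] by (simp add: p energy_def norm_mult distrib_left mult.assoc)
qed

lemma ip_add_left: "f \<in> L2 \<Longrightarrow> g \<in> L2 \<Longrightarrow> h \<in> L2 \<Longrightarrow> ip (f + g) h = ip f h + ip g h"
  unfolding ip_def
  by (subst infsum_add[symmetric])
     (auto simp: ip_summable intro!: infsum_cong, simp add: algebra_simps)

lemma ip_add_right: "f \<in> L2 \<Longrightarrow> g \<in> L2 \<Longrightarrow> h \<in> L2 \<Longrightarrow> ip f (g + h) = ip f g + ip f h"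
  unfolding ip_def
  by (subst infsum_add[symmetric])
     (auto simp: ip_summable intro!: infsum_cong, simp add: algebra_simps)

lemma ip_scale_left: "ip (scale c f) g = c * ip f g"
  unfolding ip_def by (subst infsum_cmult_right'[symmetric]) (auto intro!: infsum_cong)

lemma ip_scale_right: "ip f (scale c g) = cnj c * ip f g"
  unfolding ip_def by (subst infsum_cmult_right'[symmetric]) (auto intro!: infsum_cong)

definition delta :: "'a \<Rightarrow> 'b \<Rightarrow> ('a \<Rightarrow> 'b \<Rightarrow> complex)" where
  "delta a b = trunc {(a, b)} (\<lambda>_ _. 1)"

lemma delta_apply: "delta a b a' b' = (if a' = a \<and> b' = b then 1 else 0)"
  by (auto simp: delta_def trunc_def)

lemma delta_in_L2 [simp]: "delta a b \<in> L2"
  by (simp add: delta_def finite_trunc_in_L2)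

lemma mult_delta: "\<mu> * delta a b = scale (\<mu> a b) (delta a b)"
  by (auto simp: fun_eq_iff delta_apply)

lemma ip_delta_right: "ip f (delta a b) = of_real (W a b) * f a b"
proof -
  have "ip f (delta a b) = (\<Sum>\<^sub>\<infinity>(a, b)\<in>{(a, b)}. of_real (W a b) * f a b)"
    unfolding ip_def by (rule infsum_cong_neutral) (auto simp: delta_apply split: if_splits)
  then show ?thesis by simp
qed

lemma ip_delta_left: "ip (delta a b) f = of_real (W a b) * cnj (f a b)"
proof -
  have "ip (delta a b) f = (\<Sum>\<^sub>\<infinity>(a, b)\<in>{(a, b)}. of_real (W a b) * cnj (f a b))"
    unfolding ip_def by (rule infsum_cong_neutral) (auto simp: delta_apply split: if_splits)
  then show ?thesis by simp
qed

text \<open>Testing against the basis vectors determines the adjoint coordinate by coordinate; that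
  the conjugate multiplication is adjoint holds because the two inner products agree term by
  term.\<close>

lemma adjoint_mult_op: "adjoint_op (mult_op \<mu>) = mult_op (\<lambda>a b. cnj (\<mu> a b))" (is "?L = ?R")
proof
  show "?L \<subseteq> ?R"
  proof
    fix q assume "q \<in> ?L"
    then obtain y z where q: "q = (y, z)" and yz: "y \<in> L2" "z \<in> L2"
      and adj: "\<And>x u. (x, u) \<in> mult_op \<mu> \<Longrightarrow> ip u y = ip x z"
      unfolding adjoint_op_def by blast
    have "z a b = cnj (\<mu> a b) * y a b" for a b
    proof -
      have "(delta a b, scale (\<mu> a b) (delta a b)) \<in> mult_op \<mu>"
        by (simp add: mem_mult_op mult_delta scale_in_L2)
      from adj[OF this] have "\<mu> a b * cnj (y a b) = cnj (z a b)"
        using W_pos[of a b] by (simp add: ip_scale_left ip_delta_left)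
      then have "cnj (\<mu> a b * cnj (y a b)) = z a b" by simp
      then show ?thesis by simp
    qed
    then have "z = (\<lambda>a b. cnj (\<mu> a b)) * y" by (intro ext) simp
    then show "q \<in> ?R" using yz by (simp add: q mem_mult_op)
  qed
  show "?R \<subseteq> ?L"
    by (auto simp: adjoint_op_def mult_op_def ip_def mult_ac intro!: infsum_cong)
qed

lemma mult_op_bounded:
  assumes "\<And>a b. cmod (\<nu> a b) \<le> C"
  shows "Domain (mult_op \<nu>) = L2" "f \<in> L2 \<Longrightarrow> \<nu> * f \<in> L2"
    "f \<in> L2 \<Longrightarrow> hnorm (\<nu> * f) \<le> C * hnorm f"
proof -
  have C: "C \<ge> 0" using assms order_trans[OF norm_ge_zero] by blast
  have le: "cmod ((\<nu> * f) a b) \<le> C * cmod (f a b)" for f a b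
    using assms by (simp add: norm_mult mult_right_mono)
  show *: "\<nu> * f \<in> L2" if "f \<in> L2" for f
    by (rule dominated(1)[OF that C]) (rule le)
  show "hnorm (\<nu> * f) \<le> C * hnorm f" if "f \<in> L2"
    by (rule dominated(2)[OF that C]) (rule le)
  show "Domain (mult_op \<nu>) = L2"
    using * by (auto simp: mult_op_def Domain_iff)
qed

text \<open>The factors \<open>1 / (1 + |\<mu>|\<^sup>2)\<close>, \<open>|\<mu>| / (1 + |\<mu>|\<^sup>2)\<close> and \<open>|\<mu>|\<^sup>2 / (1 + |\<mu>|\<^sup>2)\<close> are at most 1,
  so for every \<open>y\<close> in the space the solution \<open>x = y / (1 + |\<mu>|\<^sup>2)\<close> lies in the maximal domain
  of the product. The two symbols are kept apart because the lemma serves \<open>D\<^sup>*D\<close> with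
  \<open>\<mu>' = cnj \<mu>\<close> and, with the roles exchanged, \<open>DD\<^sup>*\<close>.\<close>

lemma resolvent_mult_op:
  assumes "\<And>a b. \<mu>' a b = cnj (\<mu> a b)"
  shows "(id_plus (mult_op \<mu> O mult_op \<mu>'))\<inverse>
    = mult_op (\<lambda>a b. of_real (1 / (1 + (cmod (\<mu> a b))\<^sup>2)))" (is "?L = mult_op ?\<nu>")
proof -
  have sq: "\<mu>' a b * (\<mu> a b * z) = of_real ((cmod (\<mu> a b))\<^sup>2) * z" for a b z
    unfolding assms complex_norm_square by simp
  have nz: "1 + (complex_of_real (cmod (\<mu> a b)))\<^sup>2 \<noteq> 0" for a b
  proof -
    have "1 + (complex_of_real (cmod (\<mu> a b)))\<^sup>2 = of_real (1 + (cmod (\<mu> a b))\<^sup>2)" by simp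
    moreover have "1 + (cmod (\<mu> a b))\<^sup>2 \<noteq> 0"
      by (smt (verit) zero_le_power2)
    ultimately show ?thesis by (metis of_real_eq_0_iff)
  qed
  have "q \<in> mult_op ?\<nu>" if "q \<in> ?L" for q
  proof -
    from that obtain x where x: "q = (x + \<mu>' * (\<mu> * x), x)" "x \<in> L2" "\<mu>' * (\<mu> * x) \<in> L2"
      by (auto simp: id_plus_def mult_op_def)
    have "x = ?\<nu> * (x + \<mu>' * (\<mu> * x))"
    proof (intro ext)
      fix a b
      have "x a b + of_real ((cmod (\<mu> a b))\<^sup>2) * x a b
          = (1 + (complex_of_real (cmod (\<mu> a b)))\<^sup>2) * x a b"
        by (simp add: algebra_simps)
      then show "x a b = (?\<nu> * (x + \<mu>' * (\<mu> * x))) a b"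
        using nz[of a b] by (simp add: sq)
    qed
    then show ?thesis
      using x hnorm_add(1) by (auto simp: mem_mult_op)
  qed
  moreover have "q \<in> ?L" if "q \<in> mult_op ?\<nu>" for q
  proof -
    from that obtain y where y: "q = (y, ?\<nu> * y)" "y \<in> L2" "?\<nu> * y \<in> L2"
      by (auto simp: mult_op_def)
    let ?x = "?\<nu> * y"
    have bd: "t / (1 + t\<^sup>2) \<le> 1" "t\<^sup>2 / (1 + t\<^sup>2) \<le> 1" for t :: real
    proof -
      have "0 \<le> (t - 1)\<^sup>2" "0 \<le> t\<^sup>2" by simp_all
      then have "t \<le> 1 + t\<^sup>2" "0 < 1 + t\<^sup>2"
        by (cases "t \<ge> 0"; simp add: power2_diff; linarith)+
      then show "t / (1 + t\<^sup>2) \<le> 1" "t\<^sup>2 / (1 + t\<^sup>2) \<le> 1" by simp_all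
    qed
    have nrm: "cmod (?\<nu> a b * z) = cmod z / (1 + (cmod (\<mu> a b))\<^sup>2)" for a b z
      by (simp only: norm_mult norm_of_real) simp
    have "\<mu> * ?x \<in> L2"
    proof (rule dominated(1)[OF y(2), of 1])
      fix a b
      have "cmod ((\<mu> * ?x) a b) = cmod (\<mu> a b) / (1 + (cmod (\<mu> a b))\<^sup>2) * cmod (y a b)"
        by (simp only: times_fun_apply norm_mult[of "\<mu> a b"] nrm) simp
      also have "\<dots> \<le> 1 * cmod (y a b)"
        by (intro mult_right_mono bd) auto
      finally show "cmod ((\<mu> * ?x) a b) \<le> 1 * cmod (y a b)" .
    qed simp
    moreover have "\<mu>' * (\<mu> * ?x) \<in> L2"
    proof (rule dominated(1)[OF y(2), of 1])
      fix a b
      have "cmod ((\<mu>' * (\<mu> * ?x)) a b)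
          = (cmod (\<mu> a b))\<^sup>2 / (1 + (cmod (\<mu> a b))\<^sup>2) * cmod (y a b)"
        by (simp only: times_fun_apply sq norm_mult[of "of_real ((cmod (\<mu> a b))\<^sup>2)"] nrm norm_of_real)
           simp
      also have "\<dots> \<le> 1 * cmod (y a b)"
        by (intro mult_right_mono bd) auto
      finally show "cmod ((\<mu>' * (\<mu> * ?x)) a b) \<le> 1 * cmod (y a b)" .
    qed simp
    ultimately have "(?x, \<mu>' * (\<mu> * ?x)) \<in> mult_op \<mu> O mult_op \<mu>'"
      using y(3) by (auto simp: mem_mult_op intro!: relcompI)
    moreover have "y = ?x + \<mu>' * (\<mu> * ?x)"
    proof (intro ext)
      fix a b
      have "?x a b + of_real ((cmod (\<mu> a b))\<^sup>2) * ?x a b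
          = (1 + (complex_of_real (cmod (\<mu> a b)))\<^sup>2) * ?x a b"
        by (simp add: algebra_simps add_divide_distrib)
      also have "\<dots> = y a b"
        using nz[of a b] by simp
      finally show "y a b = (?x + \<mu>' * (\<mu> * ?x)) a b"
        by (simp only: plus_fun_apply times_fun_apply sq)
    qed
    ultimately show ?thesis
      unfolding y(1) id_plus_def by blast
  qed
  ultimately show ?thesis by blast
qed

section \<open>Positive square roots\<close>

text \<open>Uniqueness of the square root comes from the basis vectors: they are eigenvectors of the
  operator, and positivity makes them eigenvectors of any positive square root, with the
  positive root of the eigenvalue. Symmetry then leaves no freedom on the other vectors.\<close>

lemma positive_mult_op:
  assumes "\<And>a b. 0 \<le> r a b" "\<And>a b. r a b \<le> C"
  shows "positive_operator (mult_op (\<lambda>a b. of_real (r a b)))" (is "positive_operator (mult_op ?r)")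
proof -
  have bd: "cmod (?r a b) \<le> C" for a b using assms by simp
  have "ip (?r * f) f \<in> \<real>\<^sub>\<ge>\<^sub>0" for f
  proof -
    have "ip (?r * f) f = (\<Sum>\<^sub>\<infinity>p. of_real (r (fst p) (snd p) * energy f p))"
      unfolding ip_def
      by (rule infsum_cong)
         (auto simp: energy_def mult_ac simp flip: complex_norm_square)
    also have "\<dots> = of_real (\<Sum>\<^sub>\<infinity>p. r (fst p) (snd p) * energy f p)"
      by (rule infsum_complex_of_real)
    finally show ?thesis
      using assms by (auto intro!: iffD2[OF nonneg_Reals_of_real_iff] infsum_nonneg)
  qed
  then show ?thesis
    unfolding positive_operator_def bounded_operator_def
  proof (intro conjI linear_mult_op exI[of _ C])
    show "Domain (mult_op ?r) = L2" by (rule mult_op_bounded(1)[of ?r, OF bd])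
    show "\<forall>(f, g)\<in>mult_op ?r. hnorm g \<le> C * hnorm f"
      using mult_op_bounded(3)[of ?r, OF bd] by (auto simp: mem_mult_op)
  qed (auto simp: mem_mult_op)
qed

lemma linear_operator_combine:
  assumes "linear_operator S" "(x, y) \<in> S" "(x', y') \<in> S"
  shows "(x + scale c x', y + scale c y') \<in> S"
  using assms unfolding linear_operator_def by blast

text \<open>If \<open>S\<^sup>2 e = r\<^sup>2 e\<close> with \<open>r > 0\<close>, then \<open>v = S e - r e\<close> satisfies \<open>S v = - r v\<close>, which
  contradicts positivity of \<open>S\<close> unless \<open>v = 0\<close>.\<close>

lemma positive_sqrt_delta:
  assumes pos: "positive_operator S" and sq: "S O S = mult_op (\<lambda>a b. of_real ((r a b)\<^sup>2))"
    and r: "r a b > 0"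
  shows "(delta a b, scale (of_real (r a b)) (delta a b)) \<in> S"
proof -
  let ?e = "delta a b" and ?c = "complex_of_real (r a b)"
  have lin: "linear_operator S" and dom: "Domain S = L2"
    using pos by (auto simp: positive_operator_def bounded_operator_def)
  obtain y where y: "(?e, y) \<in> S" using dom delta_in_L2[of a b] by blast
  then have "y \<in> L2" using lin by (auto simp: linear_operator_def)
  then obtain z where z: "(y, z) \<in> S" using dom by blast
  then have "(?e, z) \<in> mult_op (\<lambda>a b. of_real ((r a b)\<^sup>2))" using y sq by blast
  then have zeq: "z = scale (?c\<^sup>2) ?e" by (simp add: mem_mult_op mult_delta)
  define v where "v = y + scale (- ?c) ?e"
  have v: "v \<in> L2"
    unfolding v_def using \<open>y \<in> L2\<close> by (intro hnorm_add scale_in_L2) auto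
  have "(v, z + scale (- ?c) y) \<in> S"
    unfolding v_def by (rule linear_operator_combine[OF lin z y])
  moreover have "z + scale (- ?c) y = scale (- ?c) v"
    by (auto simp: fun_eq_iff zeq v_def algebra_simps power2_eq_square)
  ultimately have "ip (scale (- ?c) v) v \<in> \<real>\<^sub>\<ge>\<^sub>0"
    using pos by (auto simp: positive_operator_def)
  then have "- r a b * (hnorm v)\<^sup>2 \<ge> 0"
    by (simp add: ip_scale_left ip_self hnorm_sq complex_nonneg_Reals_iff)
  then have "hnorm v = 0"
    using r by (simp add: mult_le_0_iff)
  then have "v = 0" using hnorm_eq_0D v by blast
  then have "y = scale ?c ?e"
    by (auto simp: fun_eq_iff v_def)
  then show ?thesis using y by simp
qed

text \<open>A positive operator is symmetric by polarization, so the coordinate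
  \<open>\<langle>S x, e\<rangle> = \<langle>x, S e\<rangle>\<close> is determined by the eigenvalue of the basis vector \<open>e\<close>.\<close>

lemma positive_coordinate:
  assumes pos: "positive_operator S" and e: "(delta a b, scale (of_real c) (delta a b)) \<in> S"
    and xy: "(x, y) \<in> S"
  shows "y a b = of_real c * x a b"
proof -
  let ?e = "delta a b"
  have lin: "linear_operator S"
    using pos by (auto simp: positive_operator_def bounded_operator_def)
  have L2: "x \<in> L2" "y \<in> L2" using lin xy by (auto simp: linear_operator_def)
  have im: "Im (ip q p) = 0" if "(p, q) \<in> S" for p q
  proof -
    have "ip q p \<in> \<real>\<^sub>\<ge>\<^sub>0" using pos that by (auto simp: positive_operator_def)
    then show ?thesis by (simp add: complex_nonneg_Reals_iff)
  qed
  define A B where "A = of_real (W a b) * y a b" and "B = of_real (W a b) * (of_real c * cnj (x a b))"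
  have *: "Im (cnj d * A + d * B) = 0" for d
  proof -
    have "(x + scale d ?e, y + scale d (scale (of_real c) ?e)) \<in> S"
      by (rule linear_operator_combine[OF lin xy e])
    from im[OF this] have "Im (ip y x + cnj d * A + (d * B + d * cnj d * of_real (c * W a b))) = 0"
      using L2
      by (simp add: ip_add_left ip_add_right ip_scale_left ip_scale_right hnorm_add scale_in_L2
          ip_delta_right ip_delta_left delta_apply A_def B_def algebra_simps)
    moreover have "Im (d * cnj d * of_real (c * W a b)) = 0"
      by (metis Im_complex_of_real complex_norm_square of_real_mult)
    ultimately show ?thesis
      using im[OF xy] by (simp only: plus_complex.simps)
  qed
  \<comment> \<open>\<open>d = 1\<close> gives the imaginary parts and \<open>d = \<i>\<close> the real parts.\<close>
  have "A = cnj B"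
    using *[of 1] *[of \<i>] by (simp add: complex_eq_iff)
  then show ?thesis
    using W_pos[of a b] by (simp add: A_def B_def)
qed

lemma pos_sqrt_mult_op:
  assumes r: "\<And>a b. 0 < r a b" "\<And>a b. r a b \<le> C"
  shows "pos_sqrt (mult_op (\<lambda>a b. of_real ((r a b)\<^sup>2))) = mult_op (\<lambda>a b. of_real (r a b))"
    (is "pos_sqrt ?T = mult_op ?r")
  unfolding pos_sqrt_def
proof (rule the_equality)
  have bd: "cmod (?r a b) \<le> C" for a b using r[of a b] by simp
  have "?r * (?r * f) = (\<lambda>a b. of_real ((r a b)\<^sup>2)) * f" for f
    by (intro ext) (simp add: power2_eq_square)
  moreover have "?r * (?r * f) \<in> L2" "?r * f \<in> L2" if "f \<in> L2" for f
    using mult_op_bounded(2)[of ?r, OF bd] that by auto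
  ultimately have "mult_op ?r O mult_op ?r = ?T"
    by (auto simp: mult_op_def relcomp_unfold)
  then show "positive_operator (mult_op ?r) \<and> mult_op ?r O mult_op ?r = ?T"
    using positive_mult_op[of r C] r by (auto simp: less_imp_le)
next
  have bd: "cmod (?r a b) \<le> C" for a b using r[of a b] by simp
  fix S assume S: "positive_operator S \<and> S O S = ?T"
  have S_sub: "y = ?r * x" "x \<in> L2" if "(x, y) \<in> S" for x y
  proof -
    show "y = ?r * x"
      using positive_coordinate[OF _ positive_sqrt_delta that] S r(1) by (intro ext) auto
    show "x \<in> L2"
      using that S by (auto simp: positive_operator_def bounded_operator_def)
  qed
  show "S = mult_op ?r"
  proof
    show "S \<subseteq> mult_op ?r"
      proof (intro subrelI)
      fix x y assume xy: "(x, y) \<in> S"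
      show "(x, y) \<in> mult_op ?r"
        unfolding mem_mult_op using S_sub[OF xy] mult_op_bounded(2)[of ?r, OF bd] by simp
    qed
    show "mult_op ?r \<subseteq> S"
    proof (clarsimp simp: mult_op_def)
      fix f assume "f \<in> L2"
      moreover have "Domain S = L2"
        using S by (auto simp: positive_operator_def bounded_operator_def)
      ultimately obtain y where y: "(f, y) \<in> S" by blast
      then show "(f, ?r * f) \<in> S" using S_sub(1)[OF y] by simp
    qed
  qed
qed

section \<open>Compactness\<close>

lemma mult_op_image_ball:
  assumes "\<And>a b. cmod (s a b) \<le> C"
  shows "mult_op s `` {f \<in> L2. hnorm f \<le> 1} = (\<lambda>f. s * f) ` {f \<in> L2. hnorm f \<le> 1}"
  using mult_op_bounded(2)[of s, OF assms] by (auto simp: mult_op_def)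

text \<open>A Fatou property: norm bounds survive coordinatewise limits.\<close>

lemma L2_pointwise_limit:
  assumes f: "\<And>n. f n \<in> L2" "\<And>n. hnorm (f n) \<le> B"
    and lim: "\<And>a b. (\<lambda>n. f n a b) \<longlonglongrightarrow> g a b"
  shows "g \<in> L2" "hnorm g \<le> B"
proof -
  have B: "B \<ge> 0" using f(2)[of 0] hnorm_nonneg order_trans by blast
  have "sum (energy g) F \<le> B\<^sup>2" if F: "finite F" for F
  proof (rule LIMSEQ_le_const2)
    show "(\<lambda>n. sum (energy (f n)) F) \<longlonglongrightarrow> sum (energy g) F"
      unfolding energy_def by (intro tendsto_intros lim)
    have "sum (energy (f n)) F \<le> B\<^sup>2" for n
      using sum_energy_le[OF f(1) F, of n] power_mono[OF f(2) hnorm_nonneg, of n 2] by simp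
    then show "\<exists>N. \<forall>n\<ge>N. sum (energy (f n)) F \<le> B\<^sup>2" by blast
  qed
  then show "g \<in> L2" "hnorm g \<le> B" using L2_bounded[OF B] by auto
qed

text \<open>A symbol that tends to zero turns bounded coordinatewise convergence into norm convergence:
  outside a finite set the factor \<open>s\<close> is small, and on the finite set finitely many coordinates
  converge. The bound 2 is the diameter of the unit ball.\<close>

lemma hnorm_mult_tendsto_0:
  assumes s: "\<And>\<epsilon>. \<epsilon> > 0 \<Longrightarrow> finite {(a, b). cmod (s a b) \<ge> \<epsilon>}"
    and h: "\<And>n. h n \<in> L2" "\<And>n. hnorm (h n) \<le> 2"
    and lim: "\<And>a b. (\<lambda>n. h n a b) \<longlonglongrightarrow> 0"
    and "\<epsilon> > 0"
  shows "\<forall>\<^sub>F n in sequentially. hnorm (s * h n) < \<epsilon>"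
proof -
  \<comment> \<open>The finite part contributes at most \<open>\<delta>\<^sup>2\<close> and the rest at most \<open>2\<^sup>2 \<delta>\<^sup>2\<close> to the squared
    norm, and \<open>5 \<delta>\<^sup>2 \<le> (\<epsilon> / 2)\<^sup>2\<close>.\<close>
  define \<delta> where "\<delta> = \<epsilon> / 8"
  define F where "F = {(a, b). cmod (s a b) \<ge> \<delta>}"
  have \<delta>: "\<delta> > 0" using \<open>\<epsilon> > 0\<close> by (simp add: \<delta>_def)
  have F: "finite F" unfolding F_def by (rule s[OF \<delta>])
  have "(\<lambda>n. sum (energy (s * h n)) F)
      \<longlonglongrightarrow> (\<Sum>p\<in>F. W (fst p) (snd p) * (cmod (s (fst p) (snd p) * 0))\<^sup>2)"
    unfolding energy_def times_fun_apply by (intro tendsto_intros lim)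
  then have "\<forall>\<^sub>F n in sequentially. sum (energy (s * h n)) F < \<delta>\<^sup>2"
    using \<delta> by (intro order_tendstoD(2)) auto
  then show ?thesis
  proof (rule eventually_mono)
    fix n assume n: "sum (energy (s * h n)) F < \<delta>\<^sup>2"
    have "sum (energy (s * h n)) E \<le> (\<epsilon> / 2)\<^sup>2" if E: "finite E" for E
    proof -
      have "energy (s * h n) p \<le> \<delta>\<^sup>2 * energy (h n) p" if "p \<notin> F" for p
      proof -
        have "(cmod (s (fst p) (snd p)))\<^sup>2 \<le> \<delta>\<^sup>2"
          using that by (intro power_mono) (auto simp: F_def split: prod.splits)
        from mult_right_mono[OF this energy_nonneg[of "h n" p]]
        show ?thesis by (simp add: energy_def norm_mult power_mult_distrib mult_ac)
      qed
      then have "sum (energy (s * h n)) (E - F) \<le> \<delta>\<^sup>2 * sum (energy (h n)) (E - F)"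
        unfolding sum_distrib_left by (intro sum_mono) auto
      also have "\<dots> \<le> \<delta>\<^sup>2 * 4"
        using sum_energy_le[OF h(1), of "E - F" n] E power_mono[OF h(2)[of n] hnorm_nonneg, of 2]
        by (intro mult_left_mono) auto
      finally have "sum (energy (s * h n)) (E - F) \<le> \<delta>\<^sup>2 * 4" .
      moreover have "sum (energy (s * h n)) (E \<inter> F) \<le> sum (energy (s * h n)) F"
        using F by (intro sum_mono2) auto
      moreover have "sum (energy (s * h n)) E
          = sum (energy (s * h n)) (E - F) + sum (energy (s * h n)) (E \<inter> F)"
        using sum.Int_Diff[OF E, of "energy (s * h n)" F] by simp
      ultimately have "sum (energy (s * h n)) E \<le> \<delta>\<^sup>2 * 5" using n by simp
      also have "\<dots> \<le> (\<epsilon> / 2)\<^sup>2" by (simp add: \<delta>_def power_divide)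
      finally show ?thesis .
    qed
    then have "hnorm (s * h n) \<le> \<epsilon> / 2"
      using \<open>\<epsilon> > 0\<close> by (intro L2_bounded(2)) auto
    then show "hnorm (s * h n) < \<epsilon>" using \<open>\<epsilon> > 0\<close> by simp
  qed
qed

text \<open>The image of the unit ball is itself sequentially compact. A diagonal subsequence of the
  preimages converges in every coordinate, its limit is again in the unit ball, and
  \<open>hnorm_mult_tendsto_0\<close> makes the images converge in norm.\<close>

lemma compact_mult_opI:
  assumes bd: "\<And>a b. cmod (s a b) \<le> C"
    and s: "\<And>\<epsilon>. \<epsilon> > 0 \<Longrightarrow> finite {(a, b). cmod (s a b) \<ge> \<epsilon>}"
  shows "compact_operator (mult_op s)"
proof -
  let ?K = "(\<lambda>f. s * f) ` {f \<in> L2. hnorm f \<le> 1}"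
  have "compactin mtopology ?K"
    unfolding compactin_sequentially
  proof (intro conjI allI impI)
    show "?K \<subseteq> L2" using mult_op_bounded(2)[of s, OF bd] by auto
    fix \<sigma> :: "nat \<Rightarrow> 'a \<Rightarrow> 'b \<Rightarrow> complex" assume "range \<sigma> \<subseteq> ?K"
    then have "\<forall>n. \<exists>f. f \<in> L2 \<and> hnorm f \<le> 1 \<and> \<sigma> n = s * f" by blast
    then obtain f where f: "\<And>n. f n \<in> L2" "\<And>n. hnorm (f n) \<le> 1" "\<And>n. \<sigma> n = s * f n"
      by metis
    \<comment> \<open>Rescaling by \<open>sqrt W\<close> bounds all coordinates by 1, uniformly in the index.\<close>
    define \<phi> where "\<phi> n p = complex_of_real (sqrt (W (fst p) (snd p))) * f n (fst p) (snd p)" for n p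
    have "cmod (\<phi> n p) \<le> 1" for n p
      using order_trans[OF coordinate_le[OF f(1)] f(2)] W_pos[of "fst p" "snd p"]
      by (simp add: \<phi>_def norm_mult)
    then obtain k where k: "strict_mono (k :: nat \<Rightarrow> nat)" "\<And>p. \<exists>l. (\<lambda>n. \<phi> (k n) p) \<longlonglongrightarrow> l"
      using function_convergent_subsequence[of "UNIV :: ('a \<times> 'b) set" \<phi> 1]
      by (metis UNIV_I countableI_type)
    then obtain l where l: "\<And>p. (\<lambda>n. \<phi> (k n) p) \<longlonglongrightarrow> l p" by metis
    define g where "g a b = l (a, b) / complex_of_real (sqrt (W a b))" for a b
    have lim: "(\<lambda>n. f (k n) a b) \<longlonglongrightarrow> g a b" for a b
    proof -
      have "(\<lambda>n. \<phi> (k n) (a, b) / complex_of_real (sqrt (W a b))) \<longlonglongrightarrow> g a b"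
        unfolding g_def using W_pos[of a b] by (intro tendsto_intros l) simp
      then show ?thesis using W_pos[of a b] by (simp add: \<phi>_def)
    qed
    have g: "g \<in> L2" "hnorm g \<le> 1"
      using L2_pointwise_limit[of "\<lambda>n. f (k n)", OF f(1) f(2) lim] by auto
    have sL2: "s * h \<in> L2" if "h \<in> L2" for h
      using mult_op_bounded(2)[of s, OF bd that] .
    have "limitin mtopology (\<sigma> \<circ> k) (s * g) sequentially"
      unfolding limitin_metric
    proof (intro conjI allI impI)
      fix \<epsilon> :: real assume "\<epsilon> > 0"
      have "\<forall>\<^sub>F n in sequentially. hnorm (s * (f (k n) - g)) < \<epsilon>"
      proof (rule hnorm_mult_tendsto_0[OF s _ _ _ \<open>\<epsilon> > 0\<close>])
        show "f (k n) - g \<in> L2" for n using f g by (intro diff_in_L2) auto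
        show "hnorm (f (k n) - g) \<le> 2" for n
          using triangle[of "f (k n)" 0 g] f(1,2)[of "k n"] g hnorm_diff_commute[of 0 g] by simp
        show "(\<lambda>n. (f (k n) - g) a b) \<longlonglongrightarrow> 0" for a b
          using lim[of a b] by (simp add: LIM_zero_iff)
      qed
      then show "\<forall>\<^sub>F n in sequentially. (\<sigma> \<circ> k) n \<in> L2 \<and> hnorm ((\<sigma> \<circ> k) n - s * g) < \<epsilon>"
        by (rule eventually_mono) (auto simp: f sL2 right_diff_distrib)
    qed (use sL2 g in auto)
    then show "\<exists>l r. l \<in> ?K \<and> strict_mono r \<and> limitin mtopology (\<sigma> \<circ> r) l sequentially"
      using g k(1) by blast
  qed
  moreover from this have "mtopology closure_of ?K = ?K"
    by (intro closure_of_closedin compactin_imp_closedin Hausdorff_space_mtopology)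
  ultimately show ?thesis
    unfolding compact_operator_def mult_op_image_ball[of s, OF bd] htop_eq
    using linear_mult_op mult_op_bounded(1)[of s, OF bd] by simp
qed

text \<open>If infinitely many values of \<open>s\<close> have modulus at least \<open>\<epsilon>\<close>, then the images of the
  corresponding normalized basis vectors are pairwise \<open>\<epsilon>\<close>-separated and have no convergent
  subsequence.\<close>

lemma compact_mult_opD:
  assumes comp: "compact_operator (mult_op s)" and bd: "\<And>a b. cmod (s a b) \<le> C" and "\<epsilon> > 0"
  shows "finite {(a, b). cmod (s a b) \<ge> \<epsilon>}"
proof (rule ccontr)
  assume "infinite {(a, b). cmod (s a b) \<ge> \<epsilon>}"
  then obtain i :: "nat \<Rightarrow> 'a \<times> 'b" where i: "inj i" "range i \<subseteq> {(a, b). cmod (s a b) \<ge> \<epsilon>}"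
    using infinite_countable_subset by blast
  have s_i: "cmod (s (fst (i n)) (snd (i n))) \<ge> \<epsilon>" for n
    using i(2) by (auto simp: image_subset_iff split: prod.splits)
  let ?K = "(\<lambda>f. s * f) ` {f \<in> L2. hnorm f \<le> 1}"
  have K: "?K \<subseteq> L2" using mult_op_bounded(2)[of s, OF bd] by auto
  have cl: "compactin mtopology (mtopology closure_of ?K)"
    using comp unfolding compact_operator_def mult_op_image_ball[of s, OF bd] htop_eq by simp
  define u where "u n = (let (a, b) = i n in scale (of_real (1 / sqrt (W a b))) (delta a b))" for n
  have u_in: "u n \<in> {f \<in> L2. hnorm f \<le> 1}" for n
  proof -
    have "energy (u n) p = (if p = i n then 1 else 0)" for p
      using W_pos[of "fst p" "snd p"]
      by (auto simp: energy_def u_def delta_apply norm_divide power_divide prod_eq_iff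
          split: prod.splits)
    then have "sum (energy (u n)) F \<le> 1\<^sup>2" if "finite F" for F
      using that by simp
    then show ?thesis using L2_bounded[of 1 "u n"] by simp
  qed
  define \<sigma> where "\<sigma> n = s * u n" for n
  have "range \<sigma> \<subseteq> mtopology closure_of ?K"
    using closure_of_subset[of ?K mtopology] K u_in by (auto simp: \<sigma>_def)
  then obtain l r where lr: "strict_mono r" "limitin mtopology (\<sigma> \<circ> r) l sequentially"
    using cl unfolding compactin_sequentially by blast
  then obtain N where N: "\<And>n. n \<ge> N \<Longrightarrow> \<sigma> (r n) \<in> L2 \<and> hnorm (\<sigma> (r n) - l) < \<epsilon> / 2" and l: "l \<in> L2"
    using \<open>\<epsilon> > 0\<close> unfolding limit_metric_sequentially by (metis half_gt_zero o_apply)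
  let ?m = "r N" and ?n = "r (Suc N)"
  obtain a b where ab: "i ?m = (a, b)" by fastforce
  have "i ?n \<noteq> (a, b)"
    using i(1) lr(1) ab by (metis injD n_not_Suc_n strict_mono_eq)
  then have "u ?n a b = 0"
    by (auto simp: u_def delta_apply split: prod.splits)
  then have "(\<sigma> ?m - \<sigma> ?n) a b = s a b / of_real (sqrt (W a b))"
    by (simp add: \<sigma>_def u_def ab delta_apply)
  then have "cmod (s a b) = sqrt (W a b) * cmod ((\<sigma> ?m - \<sigma> ?n) a b)"
    using W_pos[of a b] by (simp add: norm_divide)
  also have "\<dots> \<le> hnorm (\<sigma> ?m - \<sigma> ?n)"
    using N[of N] N[of "Suc N"] by (intro coordinate_le diff_in_L2) auto
  also have "\<dots> \<le> hnorm (\<sigma> ?m - l) + hnorm (l - \<sigma> ?n)"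
    using N[of N] N[of "Suc N"] l by (intro triangle) auto
  also have "\<dots> < \<epsilon>"
    using N[of N] N[of "Suc N"] hnorm_diff_commute[of l "\<sigma> ?n"] by simp
  finally show False using s_i[of ?m] ab by simp
qed

lemma compact_parametrices_mult_op_iff:
  "compact_parametrices (mult_op \<mu>) \<longleftrightarrow> (\<forall>R>0. finite {(a, b). cmod (\<mu> a b) \<le> R})"
proof -
  define r where "r a b = 1 / sqrt (1 + (cmod (\<mu> a b))\<^sup>2)" for a b
  have pos: "1 + t\<^sup>2 > 0" for t :: real by (smt (verit) zero_le_power2)
  have r: "0 < r a b" "r a b \<le> 1" for a b
    using pos[of "cmod (\<mu> a b)"] by (simp_all add: r_def)
  have r_sq: "(r a b)\<^sup>2 = 1 / (1 + (cmod (\<mu> a b))\<^sup>2)" for a b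
    using pos[of "cmod (\<mu> a b)"] by (simp add: r_def power_divide)
  let ?r = "\<lambda>a b. complex_of_real (r a b)"
  have bd: "cmod (?r a b) \<le> 1" for a b using r[of a b] by simp
  have "pos_sqrt ((id_plus (mult_op \<mu> O adjoint_op (mult_op \<mu>)))\<inverse>) = mult_op ?r"
    using pos_sqrt_mult_op[of r, OF r]
    by (simp only: adjoint_mult_op resolvent_mult_op r_sq)
  moreover have "pos_sqrt ((id_plus (adjoint_op (mult_op \<mu>) O mult_op \<mu>))\<inverse>) = mult_op ?r"
    using pos_sqrt_mult_op[of r, OF r]
      resolvent_mult_op[of \<mu> "\<lambda>a b. cnj (\<mu> a b)"]
    by (simp add: adjoint_mult_op r_sq)
  ultimately have "compact_parametrices (mult_op \<mu>) \<longleftrightarrow> compact_operator (mult_op ?r)"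
    by (simp add: compact_parametrices_def closed_densely_defined_mult_op)
  also have "\<dots> \<longleftrightarrow> (\<forall>\<epsilon>>0. finite {(a, b). cmod (?r a b) \<ge> \<epsilon>})"
    using compact_mult_opI[of ?r, OF bd] compact_mult_opD[of ?r, OF _ bd] by blast
  also have "\<dots> \<longleftrightarrow> (\<forall>R>0. finite {(a, b). cmod (\<mu> a b) \<le> R})"
  proof (intro iffI allI impI)
    fix R :: real assume *: "\<forall>\<epsilon>>0. finite {(a, b). cmod (?r a b) \<ge> \<epsilon>}" and "R > 0"
    have "r a b \<ge> 1 / sqrt (1 + R\<^sup>2)" if "cmod (\<mu> a b) \<le> R" for a b
      unfolding r_def using that pos
      by (intro divide_left_mono) (auto intro!: power_mono mult_pos_pos)
    then have "{(a, b). cmod (\<mu> a b) \<le> R} \<subseteq> {(a, b). cmod (?r a b) \<ge> 1 / sqrt (1 + R\<^sup>2)}"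
      using r by (auto simp: less_imp_le)
    moreover have "1 / sqrt (1 + R\<^sup>2) > 0" using pos[of R] by simp
    ultimately show "finite {(a, b). cmod (\<mu> a b) \<le> R}"
      using * finite_subset by blast
  next
    fix \<epsilon> :: real assume *: "\<forall>R>0. finite {(a, b). cmod (\<mu> a b) \<le> R}" and "\<epsilon> > 0"
    have "cmod (\<mu> a b) \<le> 1 / \<epsilon>" if "r a b \<ge> \<epsilon>" for a b
    proof -
      have "cmod (\<mu> a b) \<le> sqrt (1 + (cmod (\<mu> a b))\<^sup>2)"
        by (rule real_le_rsqrt) simp
      also have "\<dots> = 1 / r a b" by (simp add: r_def)
      also have "\<dots> \<le> 1 / \<epsilon>" using that \<open>\<epsilon> > 0\<close> r[of a b] by (intro divide_left_mono) auto
      finally show ?thesis .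
    qed
    then have "{(a, b). cmod (?r a b) \<ge> \<epsilon>} \<subseteq> {(a, b). cmod (\<mu> a b) \<le> 1 / \<epsilon>}"
      using r by (auto simp: abs_of_pos)
    moreover have "1 / \<epsilon> > 0" using \<open>\<epsilon> > 0\<close> by simp
    ultimately show "finite {(a, b). cmod (?r a b) \<ge> \<epsilon>}"
      using * finite_subset by blast
  qed
  finally show ?thesis .
qed

end

section \<open>The operator on the GNS space\<close>

lemma finite_support_in_pol_algebra:
  assumes "finite F" "\<And>m k. (m, k) \<notin> F \<Longrightarrow> a m k = 0"
  shows "a \<in> pol_algebra"
proof -
  have "{m. \<exists>k. a m k \<noteq> 0} \<subseteq> fst ` F" using assms(2) by force
  then have "finite {m. \<exists>k. a m k \<noteq> 0}" using assms(1) finite_subset by blast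
  moreover have "\<forall>\<^sub>F k in sequentially. a m k = 0" for m
  proof -
    obtain N where N: "\<And>k. k \<in> snd ` F \<Longrightarrow> k < N"
      using assms(1) finite_nat_bounded[of "snd ` F"] by auto
    have "a m k = 0" if "k \<ge> N" for k
      using assms(2)[of m k] N[of k] that by force
    then show ?thesis unfolding eventually_sequentially by blast
  qed
  ultimately show ?thesis by (auto simp: pol_algebra_def)
qed

definition mult_symbol :: "(nat \<Rightarrow> complex) \<Rightarrow> (nat \<Rightarrow> complex) \<Rightarrow> series" where
  "mult_symbol \<beta> \<alpha> = (\<lambda>m k. shift_down \<beta> (k + nat m) - \<alpha> (k + nat (- m)))"

text \<open>The rows \<open>m \<ge> 0\<close> of the symbol are the coefficients of \<open>U\<^sup>n\<close> with \<open>n = m\<close>, and the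
  rows \<open>m < 0\<close> are those of \<open>(U\<^sup>*)\<^sup>n\<close> with \<open>n = - m \<ge> 1\<close>, so the sublevel set is the disjoint
  union of injective images of the two sets of pairs.\<close>

lemma finite_mult_symbol_iff:
  "finite {(m, k). cmod (mult_symbol \<beta> \<alpha> m k) \<le> R} \<longleftrightarrow>
    finite {(k, n). cmod (shift_down \<beta> (k + n) - \<alpha> k) \<le> R} \<and>
    finite {(k, n). n \<ge> 1 \<and> cmod (shift_down \<beta> k - \<alpha> (k + n)) \<le> R}"
    (is "finite ?S \<longleftrightarrow> finite ?P \<and> finite ?Q")
proof -
  let ?p = "\<lambda>(k :: nat, n). (int n, k)" and ?q = "\<lambda>(k :: nat, n). (- int n, k)"
  have "(m, k) \<in> ?p ` ?P \<union> ?q ` ?Q \<longleftrightarrow> (m, k) \<in> ?S" for m k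
  proof (cases "m \<ge> 0")
    case True
    then have "(m, k) \<in> ?p ` ?P \<longleftrightarrow> (k, nat m) \<in> ?P" "(m, k) \<notin> ?q ` ?Q"
      by (auto simp: image_iff)
    then show ?thesis using True by (simp add: mult_symbol_def)
  next
    case False
    have "(m, k) \<in> ?q ` ?Q \<longleftrightarrow> (k, nat (- m)) \<in> ?Q" "(m, k) \<notin> ?p ` ?P"
      using False by (auto simp: image_iff)
    moreover have "nat (- m) \<ge> 1" using False by simp
    ultimately show ?thesis using False by (simp add: mult_symbol_def)
  qed
  then have "q \<in> ?p ` ?P \<union> ?q ` ?Q \<longleftrightarrow> q \<in> ?S" for q
    by (cases q) blast
  then have "?S = ?p ` ?P \<union> ?q ` ?Q" by blast
  moreover have "finite (?p ` ?P) \<longleftrightarrow> finite ?P"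
    by (rule finite_image_iff) (auto simp: inj_on_def)
  moreover have "finite (?q ` ?Q) \<longleftrightarrow> finite ?Q"
    by (rule finite_image_iff) (auto simp: inj_on_def)
  ultimately show ?thesis by (simp only: finite_Un)
qed

theorem proposition7p3:
  fixes \<alpha> \<beta> :: "nat \<Rightarrow> complex" and w :: "nat \<Rightarrow> real"
  assumes "\<beta> \<in> c_inc"
    and "\<And>k. w k > 0"
    and "w sums 1"
    and "summable (\<lambda>k. (cmod (shift_down \<beta> k - \<alpha> k))\<^sup>2 * w k)"
  shows "gns_compact_parametrices w (D_gns w \<beta> \<alpha>) \<longleftrightarrow>
    (\<forall>R>0. finite {(k, n). cmod (shift_down \<beta> (k + n) - \<alpha> k) \<le> R} \<and>
           finite {(k, n). n \<ge> 1 \<and> cmod (shift_down \<beta> k - \<alpha> (k + n)) \<le> R})"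
proof -
  interpret weighted_l2 "gns_weight w"
    using assms(2) by unfold_locales (simp add: gns_weight_def)
  have H: "gns_space w = L2" by (simp add: gns_space_def L2_def)
  have ip: "gns_ip w = ip" by (intro ext) (simp add: gns_ip_def ip_def)
  have smult: "series_smult = scale" by (intro ext) (simp add: series_smult_def)
  have D: "diag_left (shift_down \<beta>) a - diag_right a \<alpha> = mult_symbol \<beta> \<alpha> * a" for a
    by (intro ext) (simp add: diag_left_def diag_right_def mult_symbol_def algebra_simps)
  have "D_gns w \<beta> \<alpha> = op_closure (D_pol \<beta> \<alpha>)"
    by (simp add: D_gns_def H ip)
  also have "\<dots> = mult_op (mult_symbol \<beta> \<alpha>)"
  proof (rule mult_op_closure)
    fix f :: series and F :: "(int \<times> nat) set" assume "finite F"
    then have "trunc F f \<in> pol_algebra"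
      by (rule finite_support_in_pol_algebra) (simp add: trunc_def)
    then show "(trunc F f, mult_symbol \<beta> \<alpha> * trunc F f) \<in> D_pol \<beta> \<alpha>"
      by (auto simp: D_pol_def D)
  qed (auto simp: D_pol_def D)
  finally show ?thesis
    by (simp add: gns_compact_parametrices_def H ip smult compact_parametrices_mult_op_iff
        finite_mult_symbol_iff)
qed

end
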